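(* Let $n,m\in\{1,2,\dots\}$, $A\in\mathbb R^{n\times n}$, $B\in\mathbb R^{n\times m}\setminus\{0\}$ and $x_0\in\mathbb R^n\setminus\{0\}$. Assume that the time optimal control problem $(\mathcal{TP})_{x_0}$ has an admissible control. Let $\mathbb S_{x_0}$ and $\mathbb D_{x_0}$ be the sets of switching points and of switching directions of its optimal control $u^*_{x_0}$. Then: (i) If $n\ge2$ and $\mathbb S_{x_0}\ne\emptyset$, then $$\mathbb D_{x_0}\subset\partial B_1(0)\cap\left[\bigcup_{j=1}^{[n/2]}B^\top(A^\top)^{2j-1}\mathcal H_{2j-1}\right],$$ where $[s]=\max\{j\in\{0,1,2,\dots\}:j\le s\}$ and, for $j=1,\dots,n-1$, $$\mathcal H_j=\mathrm{span}\{B,AB,\dots,A^jB\}\cap\mathrm{span}\{B,AB,\dots,A^{j-1}B\}^{\perp}.$$ (ii) If $n=1$, then $\mathbb S_{x_0}=\emptyset$.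
   Context: Notation: $\mathbb R^+=(0,+\infty)$; $B_1(0)$ is the closed unit ball of $\mathbb R^m$ (Euclidean norm) centered at $0$ and $\partial B_1(0)$ its boundary. For $j\in\{0,1,2,\dots\}$, $\mathrm{span}\{B,AB,\dots,A^jB\}=\{\sum_{i=0}^jA^iBu_i:u_0,\dots,u_j\in\mathbb R^m\}\subset\mathbb R^n$; $\perp$ denotes orthogonal complement in $\mathbb R^n$. $\mathcal{PC}(\mathbb R^+;E)$ (with $\emptyset\ne E\subset\mathbb R^m$) is the set of all piecewise continuous and left continuous functions $\mathbb R^+\to E$ with finitely many discontinuities. Control system: for $u\in\mathcal{PC}(\mathbb R^+;\mathbb R^m)$, $x(\cdot;x_0,u)$ is the solution of $x'(t)=Ax(t)+Bu(t)$, $t\ge0$, $x(0)=x_0$. Problem $(\mathcal{TP})_{x_0}$: $T^*_{x_0}=\inf\{\hat t>0:\exists u\in\mathcal{PC}(\mathbb R^+;B_1(0))\text{ s.t. }x(\hat t;x_0,u)=0\}$ is the optimal time. A control $u\in\mathcal{PC}(\mathbb R^+;B_1(0))$ is admissible if $x(\hat t;x_0,u)=0$ for some $\hat t>0$. A control $u^*_{x_0}\in\mathcal{PC}(\mathbb R^+;B_1(0))$ is an optimal control if $x(T^*_{x_0};x_0,u^*_{x_0})=0$ and $u^*_{x_0}(t)=0$ for all $t>T^*_{x_0}$. When an admissible control exists, $0<T^*_{x_0}<+\infty$ and there is exactly one optimal control, denoted $u^*_{x_0}$. A switching point of $u^*_{x_0}$ is a discontinuity $\hat t$ of $u^*_{x_0}$,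 i.e. $u^*_{x_0}(\hat t)=\lim_{t\to\hat t^-}u^*_{x_0}(t)\ne\lim_{t\to\hat t^+}u^*_{x_0}(t)$; $\mathbb S_{x_0}$ is the set of all switching points lying in $(0,T^*_{x_0})$. When $\mathbb S_{x_0}\neq\emptyset$, the set of switching directions is $\mathbb D_{x_0}=\{v\in\partial B_1(0):\exists\hat t\in\mathbb S_{x_0}\text{ s.t. }\lim_{t\to\hat t^-}u^*_{x_0}(t)=v\}$. *)

theory Defs
  imports "HOL-Analysis.Analysis"
begin

text \<open>Functions on \<open>(0, \<infinity>)\<close> are represented by total functions on the reals; their values
  on \<open>(-\<infinity>, 0]\<close> are arbitrary and never matter. No one-sided limit at \<open>0\<close> is required,
  because \<open>0\<close> does not belong to the domain.\<close>

definition PC :: "'b::t2_space set \<Rightarrow> (real \<Rightarrow> 'b) set" where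
  "PC E = {u. (\<forall>t>0. u t \<in> E) \<and>
              finite {t. 0 < t \<and> \<not> isCont u t} \<and>
              (\<forall>t>0. (u \<longlongrightarrow> u t) (at_left t)) \<and>
              (\<forall>t>0. \<exists>l. (u \<longlongrightarrow> l) (at_right t))}"

text \<open>\<open>x\<close> is the solution of \<open>x' = A x + B u\<close>, \<open>x(0) = x0\<close> for a piecewise continuous
  control: a continuous function on \<open>[0, \<infinity>)\<close> satisfying the equation at every positive
  time at which the control is continuous (at a jump of \<open>B u\<close> a two-sided derivative
  does not exist). As the exceptional set is finite, \<open>x\<close> is unique on \<open>[0, \<infinity>)\<close>.\<close>

definition is_solution ::
  "real^'n^'n \<Rightarrow> real^'m^'n \<Rightarrow> real^'n \<Rightarrow> (real \<Rightarrow> real^'m) \<Rightarrow> (real \<Rightarrow> real^'n) \<Rightarrow> bool" where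
  "is_solution A B x0 u x \<longleftrightarrow>
     continuous_on {0..} x \<and> x 0 = x0 \<and>
     (\<forall>t>0. isCont u t \<longrightarrow> (x has_vector_derivative (A *v x t + B *v u t)) (at t))"

definition steers_to_zero ::
  "real^'n^'n \<Rightarrow> real^'m^'n \<Rightarrow> real^'n \<Rightarrow> (real \<Rightarrow> real^'m) \<Rightarrow> real \<Rightarrow> bool" where
  "steers_to_zero A B x0 u t \<longleftrightarrow> (\<exists>x. is_solution A B x0 u x \<and> x t = 0)"

definition admissible_control ::
  "real^'n^'n \<Rightarrow> real^'m^'n \<Rightarrow> real^'n \<Rightarrow> (real \<Rightarrow> real^'m) \<Rightarrow> bool" where
  "admissible_control A B x0 u \<longleftrightarrow> u \<in> PC (cball 0 1) \<and> (\<exists>t>0. steers_to_zero A B x0 u t)"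

definition optimal_time :: "real^'n^'n \<Rightarrow> real^'m^'n \<Rightarrow> real^'n \<Rightarrow> real" where
  "optimal_time A B x0 = Inf {t. 0 < t \<and> (\<exists>u\<in>PC (cball 0 1). steers_to_zero A B x0 u t)}"

definition optimal_control ::
  "real^'n^'n \<Rightarrow> real^'m^'n \<Rightarrow> real^'n \<Rightarrow> (real \<Rightarrow> real^'m) \<Rightarrow> bool" where
  "optimal_control A B x0 u \<longleftrightarrow>
     u \<in> PC (cball 0 1) \<and> steers_to_zero A B x0 u (optimal_time A B x0) \<and>
     (\<forall>t>optimal_time A B x0. u t = 0)"

definition switching_points ::
  "real^'n^'n \<Rightarrow> real^'m^'n \<Rightarrow> real^'n \<Rightarrow> (real \<Rightarrow> real^'m) \<Rightarrow> real set" where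
  "switching_points A B x0 u = {t. 0 < t \<and> t < optimal_time A B x0 \<and> \<not> isCont u t}"

definition switching_directions ::
  "real^'n^'n \<Rightarrow> real^'m^'n \<Rightarrow> real^'n \<Rightarrow> (real \<Rightarrow> real^'m) \<Rightarrow> (real^'m) set" where
  "switching_directions A B x0 u =
     {v \<in> sphere 0 1. \<exists>t\<in>switching_points A B x0 u. (u \<longlongrightarrow> v) (at_left t)}"

text \<open>The library's \<open>*\<close> and \<open>^\<close> on \<open>real^'n^'n\<close> are componentwise, so the
  power of a matrix with respect to \<open>**\<close> is defined here.\<close>

primrec matpow :: "real^'n^'n \<Rightarrow> nat \<Rightarrow> real^'n^'n" where
  "matpow A 0 = mat 1"
| "matpow A (Suc k) = A ** matpow A k"

definition krylov :: "real^'n^'n \<Rightarrow> real^'m^'n \<Rightarrow> nat \<Rightarrow> (real^'n) set" where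
  "krylov A B j = {(\<Sum>i\<le>j. matpow A i *v (B *v u i)) | u :: nat \<Rightarrow> real^'m. True}"

text \<open>Meaningful for \<open>j \<ge> 1\<close> only, because of the truncated \<open>j - 1\<close>.\<close>

definition krylov_increment :: "real^'n^'n \<Rightarrow> real^'m^'n \<Rightarrow> nat \<Rightarrow> (real^'n) set" where
  "krylov_increment A B j = krylov A B j \<inter> orthogonal_comp (krylov A B (j - 1))"

end

theory Submission
  imports Defs
begin

text \<open>
  Along a trajectory, \<open>e\<^bsup>-tA\<^esup> x(t)\<close> changes at the rate \<open>e\<^bsup>-tA\<^esup> B u(t)\<close>. Hence \<open>x0\<close> can be steered to
  \<open>0\<close> in time \<open>s\<close> exactly if \<open>-x0\<close> belongs to the convex set of integrals of such rates over
  \<open>[0, s]\<close>. These sets increase with \<open>s\<close>, and for \<open>s\<close> below the optimal time \<open>T\<close> they do not contain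
  \<open>-x0\<close>. Separation and a compactness argument give a nonzero direction \<open>a\<close> in the controllable subspace
  such that the optimal control maximises the integral over \<open>[0, T]\<close> of \<open>\<phi>(t) \<bullet> u(t)\<close>, where
  \<open>\<phi>(t) = B\<^sup>T p(t)\<close> is the switching function and \<open>p\<close> solves the adjoint equation
  \<open>p' = -A\<^sup>T p\<close>, \<open>p(0) = a\<close> (\<open>maximum_principle\<close>). So the optimal control is \<open>\<phi>(t)\<close> divided by its norm
  wherever it is continuous and \<open>\<phi>(t)\<close> is not zero (\<open>optimal_control_eq_sgn\<close>).

  At a switching time \<open>t\<close> let \<open>k\<close> be the order of \<open>t\<close> as a zero of \<open>\<phi>\<close>. It is finite, because \<open>a\<close> lies in
  the controllable subspace (\<open>costate_detected\<close>). The direction of \<open>\<phi>\<close> reverses at \<open>t\<close> if \<open>k\<close> is odd and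
  extends continuously if \<open>k\<close> is even; since the control jumps, \<open>k\<close> is odd, and the left limit is a
  positive multiple of \<open>B\<^sup>T (A\<^sup>T)\<^sup>k p(t)\<close> (\<open>switching_point_structure\<close>). The vanishing of the
  derivatives of lower order says that \<open>p(t)\<close> is orthogonal to \<open>krylov A B (k - 1)\<close>, and its projection
  to \<open>krylov A B k\<close>, which has the same image, lies in \<open>krylov_increment A B k\<close>
  (\<open>krylov_increment_image\<close>). Finally, \<open>k\<close> is less than the dimension \<open>n\<close>, because the Krylov spaces
  grow strictly up to stage \<open>k\<close> (\<open>krylov_order_bound\<close>). Writing \<open>k = 2j - 1\<close> gives the first
  claim. The second one holds as no odd \<open>k\<close> is less than \<open>1\<close>.
\<close>

section \<open>Krylov spaces\<close>

lemma matrix_vector_mult_sum: "A *v (\<Sum>i\<in>I. f i) = (\<Sum>i\<in>I. (A::real^'n^'m) *v f i)"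
  by (rule linear_sum) simp

lemma matpow_Suc_right: "matpow A (Suc k) = matpow A k ** A"
  by (induction k) (simp_all add: matrix_mul_assoc)

lemma matpow_transpose: "matpow (transpose A) k = transpose (matpow A k)"
proof (induction k)
  case (Suc k)
  then show ?case
    by (simp only: matpow.simps(2)[of "transpose A"] matpow_Suc_right[of A] matrix_transpose_mul)
qed simp

lemma inner_matrix_vector_mult: "w \<bullet> ((A::real^'n^'m) *v x) = (transpose A *v w) \<bullet> x"
  by (simp add: dot_lmul_matrix)

text \<open>The adjoint form of the generators \<open>A\<^sup>i B y\<close> of the Krylov spaces: it turns orthogonality to
  these spaces into the vanishing of the vectors \<open>B\<^sup>T (A\<^sup>T)\<^sup>i w\<close>, which are, up to sign, the
  derivatives of the switching function.\<close>

lemma inner_matpow_mult: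
  fixes A :: "real^'n^'n" and B :: "real^'m^'n"
  shows "w \<bullet> (matpow A i *v (B *v y)) = ((transpose B ** matpow (transpose A) i) *v w) \<bullet> y"
  by (simp only: inner_matrix_vector_mult matpow_transpose flip: matrix_vector_mul_assoc)

lemma subspace_krylov: "subspace (krylov A B j)"
  unfolding subspace_def
proof (intro conjI ballI allI)
  show "0 \<in> krylov A B j"
    unfolding krylov_def by (rule CollectI, rule exI[of _ "\<lambda>_. 0"]) simp
next
  fix p q assume "p \<in> krylov A B j" "q \<in> krylov A B j"
  then obtain u v where "p = (\<Sum>i\<le>j. matpow A i *v (B *v u i))" "q = (\<Sum>i\<le>j. matpow A i *v (B *v v i))"
    unfolding krylov_def by blast
  then have "p + q = (\<Sum>i\<le>j. matpow A i *v (B *v (u i + v i)))"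
    by (simp add: sum.distrib matrix_vector_right_distrib)
  then show "p + q \<in> krylov A B j"
    unfolding krylov_def by (intro CollectI exI[of _ "\<lambda>i. u i + v i"]) simp
next
  fix c p assume "p \<in> krylov A B j"
  then obtain u where "p = (\<Sum>i\<le>j. matpow A i *v (B *v u i))"
    unfolding krylov_def by blast
  then have "c *\<^sub>R p = (\<Sum>i\<le>j. matpow A i *v (B *v (c *\<^sub>R u i)))"
    by (simp add: scaleR_sum_right matrix_vector_mult_scaleR)
  then show "c *\<^sub>R p \<in> krylov A B j"
    unfolding krylov_def by (intro CollectI exI[of _ "\<lambda>i. c *\<^sub>R u i"]) simp
qed

lemma krylov_generator:
  assumes "i \<le> j" shows "matpow A i *v (B *v y) \<in> krylov A B j"
proof -
  \<comment> \<open>The coefficient sequence of the generator is \<open>y\<close> at \<open>i\<close> and zero elsewhere.\<close>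
  have "matpow A l *v (B *v (if l = i then y else 0)) = (if l = i then matpow A i *v (B *v y) else 0)" for l
    by simp
  then have "(\<Sum>l\<le>j. matpow A l *v (B *v (if l = i then y else 0))) = matpow A i *v (B *v y)"
    using assms by (simp only: sum.delta finite_atMost) simp
  then show ?thesis
    unfolding krylov_def by (intro CollectI exI[of _ "\<lambda>l. if l = i then y else 0"]) simp
qed

lemma krylov_subset:
  assumes "subspace V" "\<And>i y. i \<le> j \<Longrightarrow> matpow A i *v (B *v y) \<in> V"
  shows "krylov A B j \<subseteq> V"
  using assms by (auto simp: krylov_def intro!: subspace_sum)

lemma krylov_mono: "i \<le> j \<Longrightarrow> krylov A B i \<subseteq> krylov A B j"
  by (intro krylov_subset subspace_krylov krylov_generator) simp

lemma mult_krylov: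
  assumes "p \<in> krylov A B j" shows "A *v p \<in> krylov A B (Suc j)"
proof -
  obtain u where "p = (\<Sum>i\<le>j. matpow A i *v (B *v u i))"
    using assms unfolding krylov_def by blast
  then have "A *v p = (\<Sum>i\<le>j. matpow A (Suc i) *v (B *v u i))"
    by (simp add: matrix_vector_mult_sum flip: matrix_vector_mul_assoc)
  also have "\<dots> \<in> krylov A B (Suc j)"
    by (intro subspace_sum subspace_krylov krylov_generator) auto
  finally show ?thesis .
qed

text \<open>If one step adds nothing, then \<open>A\<close> maps \<open>krylov A B i\<close> into itself, so no later step adds
  anything either.\<close>

lemma krylov_stabilises:
  assumes "krylov A B (Suc i) \<subseteq> krylov A B i"
  shows "krylov A B j \<subseteq> krylov A B i"
proof -
  have "matpow A l *v (B *v y) \<in> krylov A B i" for l y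
  proof (induction l)
    case 0
    show ?case by (rule krylov_generator) simp
  next
    case (Suc l)
    have "matpow A (Suc l) *v (B *v y) = A *v (matpow A l *v (B *v y))"
      by (simp flip: matrix_vector_mul_assoc)
    with mult_krylov[OF Suc] assms show ?case by auto
  qed
  then show ?thesis by (intro krylov_subset subspace_krylov)
qed

text \<open>A step that still adds something at stage \<open>k\<close> means that every earlier step did, since the chain
  is constant once it stalls. The dimension therefore grows by at least one per step, starting from
  at least one because \<open>B\<close> is nonzero. This dimension count is what bounds the order of a zero of
  the switching function.\<close>

lemma krylov_growth_bound:
  fixes A :: "real^'n^'n" and B :: "real^'m^'n"
  assumes "B \<noteq> 0" and "\<And>i. i < k \<Longrightarrow> \<not> krylov A B k \<subseteq> krylov A B i"
  shows "k < CARD('n)"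
proof -
  have "i \<le> k \<Longrightarrow> i < dim (krylov A B i)" for i
  proof (induction i)
    case 0
    obtain y where "B *v y \<noteq> 0"
      using assms(1) by (metis matrix_eq matrix_vector_mult_0)
    moreover have "B *v y \<in> krylov A B 0"
      using krylov_generator[of 0 0 A B y] by simp
    ultimately have "\<not> krylov A B 0 \<subseteq> {0}" by auto
    then show ?case using dim_eq_0 by (metis gr0I)
  next
    case (Suc i)
    have "\<not> krylov A B (Suc i) \<subseteq> krylov A B i"
      using krylov_stabilises[of A B i k] assms(2)[of i] Suc.prems by auto
    with krylov_mono[of i "Suc i" A B] have "krylov A B i \<subset> krylov A B (Suc i)" by auto
    then have "dim (krylov A B i) < dim (krylov A B (Suc i))"
      by (intro dim_psubset) (simp add: span_eq_iff[THEN iffD2, OF subspace_krylov])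
    with Suc show ?case by simp
  qed
  then have "k < dim (krylov A B k)" by simp
  also have "\<dots> \<le> CARD('n)" using dim_subset_UNIV_cart by blast
  finally show ?thesis .
qed

lemma orthogonal_comp_krylov_iff:
  fixes A :: "real^'n^'n" and B :: "real^'m^'n"
  shows "w \<in> orthogonal_comp (krylov A B j) \<longleftrightarrow>
         (\<forall>i\<le>j. (transpose B ** matpow (transpose A) i) *v w = 0)"
proof
  assume w: "w \<in> orthogonal_comp (krylov A B j)"
  show "\<forall>i\<le>j. (transpose B ** matpow (transpose A) i) *v w = 0"
  proof (intro allI impI)
    fix i assume "i \<le> j"
    let ?p = "(transpose B ** matpow (transpose A) i) *v w"
    have "\<forall>x\<in>krylov A B j. w \<bullet> x = 0"
      using w by (simp add: orthogonal_comp_def orthogonal_def inner_commute)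
    then have "w \<bullet> (matpow A i *v (B *v ?p)) = 0"
      by (rule bspec) (rule krylov_generator[OF \<open>i \<le> j\<close>])
    then show "?p = 0" unfolding inner_matpow_mult inner_eq_zero_iff .
  qed
next
  assume *: "\<forall>i\<le>j. (transpose B ** matpow (transpose A) i) *v w = 0"
  have "krylov A B j \<subseteq> {x. w \<bullet> x = 0}"
    by (rule krylov_subset[OF subspace_hyperplane]) (use * in \<open>simp only: inner_matpow_mult mem_Collect_eq inner_zero_left\<close>)
  then show "w \<in> orthogonal_comp (krylov A B j)"
    by (auto simp: orthogonal_comp_def orthogonal_def inner_commute)
qed

text \<open>The vector \<open>B\<^sup>T (A\<^sup>T)\<^sup>k w\<close> only sees the orthogonal projection \<open>h\<close> of \<open>w\<close> to \<open>krylov A B k\<close>,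
  because it is determined by the inner products of \<open>w\<close> with the vectors \<open>A\<^sup>k B y\<close>. Projecting does
  not destroy orthogonality to the smaller Krylov space, so \<open>h\<close> lies in the increment.\<close>

lemma krylov_increment_image:
  fixes A :: "real^'n^'n" and B :: "real^'m^'n"
  assumes "k > 0" and "\<And>i. i < k \<Longrightarrow> (transpose B ** matpow (transpose A) i) *v w = 0"
  shows "(transpose B ** matpow (transpose A) k) *v w
         \<in> (\<lambda>h. (transpose B ** matpow (transpose A) k) *v h) ` krylov_increment A B k"
proof -
  let ?M = "\<lambda>i. transpose B ** matpow (transpose A) i"
  obtain h q where h: "h \<in> span (krylov A B k)"
    and q: "\<And>v. v \<in> span (krylov A B k) \<Longrightarrow> orthogonal q v" and w: "w = h + q"
    using orthogonal_subspace_decomp_exists[of "krylov A B k" w] by metis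
  have "q \<in> orthogonal_comp (krylov A B k)"
    using q by (auto simp: orthogonal_comp_def orthogonal_commute span_base)
  then have q0: "?M i *v q = 0" if "i \<le> k" for i
    using that unfolding orthogonal_comp_krylov_iff by blast
  have Mh: "?M i *v h = ?M i *v w" if "i \<le> k" for i
    unfolding w matrix_vector_right_distrib using q0[OF that] by simp
  have "h \<in> orthogonal_comp (krylov A B (k - 1))"
    unfolding orthogonal_comp_krylov_iff
  proof (intro allI impI)
    fix i assume "i \<le> k - 1"
    then show "?M i *v h = 0" using assms Mh[of i] by simp
  qed
  then have "h \<in> krylov_increment A B k"
    using h by (simp add: krylov_increment_def span_eq_iff[THEN iffD2, OF subspace_krylov])
  then show ?thesis
    by (intro image_eqI) (use Mh[of k] in \<open>auto\<close>)
qed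

text \<open>Applied to a costate \<open>w\<close> at a switching time, this says that the switching function has no zero
  of order \<open>n\<close> or more, where \<open>n\<close> is the dimension of the state space.\<close>

lemma krylov_order_bound:
  fixes A :: "real^'n^'n" and B :: "real^'m^'n"
  assumes "B \<noteq> 0" and "\<And>i. i < k \<Longrightarrow> (transpose B ** matpow (transpose A) i) *v w = 0"
    and "(transpose B ** matpow (transpose A) k) *v w \<noteq> 0"
  shows "k < CARD('n)"
proof (rule krylov_growth_bound[OF assms(1)])
  fix i assume "i < k"
  then have "w \<in> orthogonal_comp (krylov A B i)"
    unfolding orthogonal_comp_krylov_iff using assms(2) by auto
  moreover have "w \<notin> orthogonal_comp (krylov A B k)"
    unfolding orthogonal_comp_krylov_iff using assms(3) by auto
  ultimately show "\<not> krylov A B k \<subseteq> krylov A B i"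
    unfolding orthogonal_comp_def by auto
qed

section \<open>The matrix exponential\<close>

text \<open>Termwise differentiation of an exponential generating function shifts its coefficients. It is
  reduced to real power series by taking coordinates.\<close>

lemma has_vector_derivative_exp_series:
  fixes c :: "nat \<Rightarrow> 'a::euclidean_space"
  assumes sm: "\<And>t. summable (\<lambda>k. (t ^ k / fact k) *\<^sub>R c k)"
    and sm': "\<And>t. summable (\<lambda>k. (t ^ k / fact k) *\<^sub>R c (Suc k))"
  shows "((\<lambda>t. \<Sum>k. (t ^ k / fact k) *\<^sub>R c k) has_vector_derivative
           (\<Sum>k. (t ^ k / fact k) *\<^sub>R c (Suc k))) (at t)"
  unfolding has_vector_derivative_def
proof (rule has_derivative_componentwise_within[THEN iffD2], rule ballI)
  fix b :: 'a assume "b \<in> Basis"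
  have coord: "(\<Sum>k. (s ^ k / fact k) *\<^sub>R d k) \<bullet> b = (\<Sum>k. (d k \<bullet> b / fact k) * s ^ k)"
    if "summable (\<lambda>k. (s ^ k / fact k) *\<^sub>R d k)" for d s
  proof -
    have "(\<Sum>k. (s ^ k / fact k) *\<^sub>R d k) \<bullet> b = (\<Sum>k. ((s ^ k / fact k) *\<^sub>R d k) \<bullet> b)"
      by (rule bounded_linear.suminf[OF bounded_linear_inner_left that])
    also have "\<dots> = (\<Sum>k. (d k \<bullet> b / fact k) * s ^ k)" by (simp add: mult.commute)
    finally show ?thesis .
  qed
  have diffs: "diffs (\<lambda>k. c k \<bullet> b / fact k) = (\<lambda>k. c (Suc k) \<bullet> b / fact k)"
    by (auto simp: diffs_def field_simps fact_Suc simp del: of_nat_Suc)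
  have "summable (\<lambda>k. (c k \<bullet> b / fact k) * s ^ k)" for s
    using bounded_linear.summable[OF bounded_linear_inner_left sm, of s b] by (simp add: field_simps)
  from termdiffs_strong_converges_everywhere[OF this, of t]
  have "((\<lambda>s. \<Sum>k. (c k \<bullet> b / fact k) * s ^ k) has_real_derivative
         (\<Sum>k. (t ^ k / fact k) *\<^sub>R c (Suc k)) \<bullet> b) (at t)"
    unfolding diffs coord[OF sm'] .
  then show "((\<lambda>s. (\<Sum>k. (s ^ k / fact k) *\<^sub>R c k) \<bullet> b) has_derivative
     (\<lambda>s. (s *\<^sub>R (\<Sum>k. (t ^ k / fact k) *\<^sub>R c (Suc k))) \<bullet> b)) (at t)"
    unfolding coord[OF sm] has_field_derivative_def
    by (rule has_derivative_eq_rhs) (simp add: fun_eq_iff)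
qed

lemma bounded_bilinear_matrix_matrix_mult:
  "bounded_bilinear (\<lambda>(A::real^'n^'m) (B::real^'k^'n). A ** B)"
  unfolding bilinear_conv_bounded_bilinear[symmetric] bilinear_def
  by (auto intro!: linearI simp: matrix_matrix_mult_def vec_eq_iff sum_distrib_left sum.distrib
      algebra_simps)

lemma bounded_bilinear_matrix_vector_mult:
  "bounded_bilinear (\<lambda>(A::real^'n^'m) x. A *v x)"
  unfolding bilinear_conv_bounded_bilinear[symmetric] bilinear_def
  by (auto intro!: linearI simp: 
    matrix_vector_mult_def vec_eq_iff sum_distrib_left sum.distrib algebra_simps)

text \<open>The matrix exponential \<open>e\<^bsup>tA\<^esup>\<close>. It is defined by its series because the matrix
  product \<open>**\<close> is not the ring multiplication of the type.\<close>

definition mexp :: "real^'n^'n \<Rightarrow> real \<Rightarrow> real^'n^'n" where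
  "mexp A t = (\<Sum>k. (t ^ k / fact k) *\<^sub>R matpow A k)"

text \<open>The geometric bound behind the convergence of the exponential series. The rate \<open>r\<close> is the norm of
  \<open>A\<close> times a constant of the bounded bilinear matrix product.\<close>

lemma matpow_bound:
  fixes A :: "real^'n^'n"
  obtains r M where "\<And>k. norm (matpow A k) \<le> M * r ^ k"
proof -
  obtain K where K: "K \<ge> 0" "\<forall>(X::real^'n^'n) (Y::real^'n^'n). norm (X ** Y) \<le> norm X * norm Y * K"
    using bounded_bilinear.nonneg_bounded[OF bounded_bilinear_matrix_matrix_mult[where 'n = 'n and 'm = 'n and 'k = 'n]]
    by (elim exE conjE) (rule that)
  have "norm (matpow A k) \<le> norm (mat 1 :: real^'n^'n) * (norm A * K) ^ k" for k
  proof (induction k)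
    case (Suc k)
    have "norm (matpow A (Suc k)) \<le> (norm A * K) * norm (matpow A k)"
      using K(2)[rule_format, of A "matpow A k"] by (simp add: ac_simps)
    also have "\<dots> \<le> (norm A * K) * (norm (mat 1 :: real^'n^'n) * (norm A * K) ^ k)"
      by (intro mult_left_mono Suc) (use K(1) in simp)
    finally show ?case by (simp add: ac_simps)
  qed simp
  then show thesis by (rule that)
qed

lemma summable_mexp: "summable (\<lambda>k. (t ^ k / fact k) *\<^sub>R matpow A k)"
proof -
  obtain r M where M: "\<And>k. norm (matpow A k) \<le> M * r ^ k" by (rule matpow_bound) blast
  have "summable (\<lambda>k. M * ((\<bar>t\<bar> * r) ^ k /\<^sub>R fact k))"
    by (intro summable_mult summable_exp_generic)
  then show ?thesis
  proof (rule summable_comparison_test'[where N = 0])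
    fix k
    have "norm ((t ^ k / fact k) *\<^sub>R matpow A k) \<le> (\<bar>t\<bar> ^ k / fact k) * (M * r ^ k)"
      using mult_left_mono[OF M[of k], of "\<bar>t\<bar> ^ k / fact k"] by (simp add: power_abs)
    then show "norm ((t ^ k / fact k) *\<^sub>R matpow A k) \<le> M * ((\<bar>t\<bar> * r) ^ k /\<^sub>R fact k)"
      by (simp add: power_mult_distrib field_simps)
  qed
qed

lemma mexp_mult_left:
  fixes A :: "real^'n^'n"
  shows "summable (\<lambda>k. (t ^ k / fact k) *\<^sub>R matpow A (Suc k))"
    and "A ** mexp A t = (\<Sum>k. (t ^ k / fact k) *\<^sub>R matpow A (Suc k))"
proof -
  interpret L: bounded_linear "\<lambda>X. A ** (X::real^'n^'n)"
    by (rule bounded_bilinear.bounded_linear_right[OF bounded_bilinear_matrix_matrix_mult])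
  show "summable (\<lambda>k. (t ^ k / fact k) *\<^sub>R matpow A (Suc k))"
    using L.summable[OF summable_mexp, of t A] by (simp add: L.scaleR)
  show "A ** mexp A t = (\<Sum>k. (t ^ k / fact k) *\<^sub>R matpow A (Suc k))"
    using L.suminf[OF summable_mexp, of t A] by (simp add: L.scaleR mexp_def)
qed

lemma mexp_commute: "mexp A t ** A = A ** mexp (A::real^'n^'n) t"
proof -
  interpret L: bounded_linear "\<lambda>X. X ** A"
    by (rule bounded_bilinear.bounded_linear_left[OF bounded_bilinear_matrix_matrix_mult])
  have "mexp A t ** A = (\<Sum>k. ((t ^ k / fact k) *\<^sub>R matpow A k) ** A)"
    unfolding mexp_def by (rule L.suminf[OF summable_mexp])
  also have "\<dots> = (\<Sum>k. (t ^ k / fact k) *\<^sub>R matpow A (Suc k))"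
    unfolding L.scaleR matpow_Suc_right ..
  also have "\<dots> = A ** mexp A t"
    by (rule mexp_mult_left(2)[symmetric])
  finally show ?thesis .
qed

lemma mexp_has_vector_derivative:
  "((\<lambda>t. mexp A t) has_vector_derivative A ** mexp A t) (at t within S)"
  unfolding mexp_mult_left unfolding mexp_def
  by (rule has_vector_derivative_at_within[OF has_vector_derivative_exp_series])
    (rule summable_mexp mexp_mult_left(1))+

lemma mexp_minus_has_vector_derivative:
  "((\<lambda>t. mexp A (- t)) has_vector_derivative - (A ** mexp A (- t))) (at t within S)"
proof -
  have "((\<lambda>t. - t :: real) has_vector_derivative - 1) (at t within S)"
    by (auto intro!: derivative_eq_intros)
  from vector_diff_chain_within[OF this mexp_has_vector_derivative[of A]]
  show ?thesis unfolding o_def scaleR_minus_left scaleR_one .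
qed

lemma mexp_0: "mexp (A::real^'n^'n) 0 = mat 1"
proof -
  have "(\<lambda>k. (0 ^ k / fact k) *\<^sub>R matpow A k) = (\<lambda>k. if k = 0 then mat 1 else 0)" by auto
  then show ?thesis
    unfolding mexp_def using sums_single[of 0 "\<lambda>_. mat 1 :: real^'n^'n"] by (simp add: sums_iff)
qed

text \<open>The product has derivative zero because \<open>A\<close> commutes with its exponential.\<close>

lemma mexp_mult_mexp_minus: "mexp (A::real^'n^'n) t ** mexp A (- t) = mat 1"
proof -
  interpret B: bounded_bilinear "\<lambda>(A::real^'n^'n) (B::real^'n^'n). A ** B"
    by (rule bounded_bilinear_matrix_matrix_mult)
  have "((\<lambda>t. mexp A t ** mexp A (- t)) has_vector_derivative 0) (at t within UNIV)" for t
  proof -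
    have "mexp A t ** - (A ** mexp A (- t)) + (A ** mexp A t) ** mexp A (- t) = 0"
      by (simp add: B.minus_right matrix_mul_assoc mexp_commute)
    with B.has_vector_derivative[OF mexp_has_vector_derivative[of A t UNIV]
        mexp_minus_has_vector_derivative[of A t UNIV]]
    show ?thesis by metis
  qed
  then obtain c where "\<And>t. mexp A t ** mexp A (- t) = c"
    by (rule has_vector_derivative_zero_constant[OF convex_UNIV, simplified]) blast+
  from this[of t] this[of 0] show ?thesis by (simp add: mexp_0)
qed

lemma mexp_minus_mult_mexp: "mexp A (- t) ** mexp A t = mat 1"
  using mexp_mult_mexp_minus[of A "- t"] by simp

text \<open>The partial sums of the exponential series, applied to \<open>v\<close>, stay in \<open>V\<close>, and a subspace of a
  finite-dimensional space is closed.\<close>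

lemma mexp_invariant_subspace:
  fixes A :: "real^'n^'n"
  assumes "subspace V" "\<And>v. v \<in> V \<Longrightarrow> A *v v \<in> V" "v \<in> V"
  shows "mexp A t *v v \<in> V"
proof -
  interpret L: bounded_linear "\<lambda>X::real^'n^'n. X *v v"
    by (rule bounded_bilinear.bounded_linear_left[OF bounded_bilinear_matrix_vector_mult])
  have mem: "matpow A k *v v \<in> V" for k
  proof (induction k)
    case (Suc k)
    have "matpow A (Suc k) *v v = A *v (matpow A k *v v)"
      by (simp flip: matrix_vector_mul_assoc)
    with assms(2)[OF Suc] show ?case by (simp only:)
  qed (simp add: assms(3))
  have "(\<Sum>k<N. ((t ^ k / fact k) *\<^sub>R matpow A k) *v v) \<in> V" for N
    unfolding L.scaleR by (intro subspace_sum subspace_scale assms(1) mem)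
  moreover have "(\<lambda>N. \<Sum>k<N. ((t ^ k / fact k) *\<^sub>R matpow A k) *v v) \<longlonglongrightarrow> mexp A t *v v"
    using L.sums[OF summable_sums[OF summable_mexp]] unfolding mexp_def sums_def .
  ultimately show ?thesis
    by (rule closed_sequentially[OF closed_subspace[OF assms(1)]])
qed

section \<open>The leading Taylor term\<close>

text \<open>Peano's form of Taylor's theorem for the first nonvanishing derivative: \<open>f i\<close> is the \<open>i\<close>-th
  derivative of \<open>f 0\<close>. The induction is l'Hopital's rule in each coordinate, applied to the shifted
  sequence of derivatives.\<close>

lemma Taylor_leading_term:
  fixes f :: "nat \<Rightarrow> real \<Rightarrow> 'a::euclidean_space"
  assumes "\<And>i t. (f i has_vector_derivative f (Suc i) t) (at t)"
    and "\<And>i. i < k \<Longrightarrow> f i a = 0"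
  shows "((\<lambda>t. f 0 t /\<^sub>R (t - a) ^ k) \<longlongrightarrow> f k a /\<^sub>R fact k) (at a)"
  using assms
proof (induction k arbitrary: f)
  case 0
  have "isCont (f 0) a"
    by (rule has_vector_derivative_continuous[OF 0(1)])
  then show ?case by (simp add: isCont_def)
next
  case (Suc k)
  have IH: "((\<lambda>t. f 1 t /\<^sub>R (t - a) ^ k) \<longlongrightarrow> f (Suc k) a /\<^sub>R fact k) (at a)"
    using Suc.IH[of "\<lambda>i. f (Suc i)", OF Suc.prems(1) Suc.prems(2)] by simp
  show ?case
  proof (rule tendsto_componentwise_iff[THEN iffD2], rule ballI)
    fix b :: 'a assume "b \<in> Basis"
    have "((\<lambda>t. (f 0 t \<bullet> b) / (t - a) ^ Suc k) \<longlongrightarrow> f (Suc k) a \<bullet> b / fact (Suc k)) (at a)"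
    proof (rule lhopital[where f' = "\<lambda>t. f 1 t \<bullet> b" and g' = "\<lambda>t. Suc k * (t - a) ^ k"])
      have "isCont (f 0) a"
        by (rule has_vector_derivative_continuous[OF Suc.prems(1)])
      then have "((\<lambda>t. f 0 t \<bullet> b) \<longlongrightarrow> f 0 a \<bullet> b) (at a)"
        by (intro tendsto_intros) (simp add: isCont_def)
      then show "((\<lambda>t. f 0 t \<bullet> b) \<longlongrightarrow> 0) (at a)" using Suc.prems(2)[of 0] by simp
      have "isCont (\<lambda>t. (t - a) ^ Suc k) a" by (intro continuous_intros)
      then show "((\<lambda>t. (t - a) ^ Suc k) \<longlongrightarrow> 0) (at a)" by (simp add: isCont_def)
      show "\<forall>\<^sub>F t in at a. (t - a) ^ Suc k \<noteq> 0" "\<forall>\<^sub>F t in at a. Suc k * (t - a) ^ k \<noteq> 0"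
        unfolding eventually_at by (auto intro!: exI[of _ 1])
      have "((\<lambda>t. f 0 t \<bullet> b) has_real_derivative f 1 t \<bullet> b) (at t)" for t
        using bounded_linear.has_vector_derivative[OF bounded_linear_inner_left Suc.prems(1)[of 0 t], of b]
        by (simp add: has_real_derivative_iff_has_vector_derivative)
      then show "\<forall>\<^sub>F t in at a. ((\<lambda>t. f 0 t \<bullet> b) has_real_derivative f 1 t \<bullet> b) (at t)" by simp
      have "((\<lambda>t. (t - a) ^ Suc k) has_real_derivative Suc k * (t - a) ^ k) (at t)" for t
        by (auto intro!: derivative_eq_intros simp del: power_Suc)
      then show "\<forall>\<^sub>F t in at a. ((\<lambda>t. (t - a) ^ Suc k) has_real_derivative Suc k * (t - a) ^ k) (at t)"
        by simp
      have "((\<lambda>t. ((f 1 t /\<^sub>R (t - a) ^ k) \<bullet> b) / Suc k) \<longlongrightarrow> ((f (Suc k) a /\<^sub>R fact k) \<bullet> b) / Suc k) (at a)"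
        by (intro tendsto_intros IH) simp
      then show "((\<lambda>t. f 1 t \<bullet> b / (Suc k * (t - a) ^ k)) \<longlongrightarrow> f (Suc k) a \<bullet> b / fact (Suc k)) (at a)"
        by (simp add: field_simps del: of_nat_Suc)
    qed
    then show "((\<lambda>t. (f 0 t /\<^sub>R (t - a) ^ Suc k) \<bullet> b) \<longlongrightarrow> (f (Suc k) a /\<^sub>R fact (Suc k)) \<bullet> b) (at a)"
      by (simp add: field_simps del: power_Suc fact_Suc)
  qed
qed

section \<open>Separation and the equality case of Cauchy--Schwarz\<close>

text \<open>The sets of unit vectors in \<open>V\<close> that separate \<open>p\<close> from \<open>N n\<close> are compact, nonempty and decreasing
  in \<open>n\<close>, so they have a common element. The direction must be found inside \<open>V\<close>: a normal vector
  orthogonal to \<open>V\<close> would satisfy the inequality trivially and carry no information.\<close>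

lemma common_supporting_direction:
  fixes N :: "nat \<Rightarrow> 'a::euclidean_space set"
  assumes "subspace V" "p \<in> V"
    and N: "\<And>n. convex (N n)" "\<And>n. N n \<noteq> {}" "\<And>n. N n \<subseteq> V" "\<And>n. p \<notin> N n"
    and mono: "\<And>m n. m \<le> n \<Longrightarrow> N m \<subseteq> N n"
  obtains a where "a \<in> V" "a \<noteq> 0" "\<And>n q. q \<in> N n \<Longrightarrow> a \<bullet> q \<le> a \<bullet> p"
proof -
  define F where "F n = {a. norm a = 1} \<inter> V \<inter> (\<Inter>q\<in>N n. {a. a \<bullet> q \<le> a \<bullet> p})" for n
  have "compact (F n)" for n
  proof -
    have "F n = sphere 0 1 \<inter> (V \<inter> (\<Inter>q\<in>N n. {a. a \<bullet> (q - p) \<le> 0}))"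
      by (auto simp: F_def inner_diff_right)
    moreover have "closed (V \<inter> (\<Inter>q\<in>N n. {a. a \<bullet> (q - p) \<le> 0}))"
    proof (intro closed_Int closed_INT ballI)
      show "closed V" by (rule closed_subspace[OF assms(1)])
      show "closed {a. a \<bullet> (q - p) \<le> 0}" for q
        using closed_halfspace_le[of "q - p" 0] by (simp add: inner_commute)
    qed
    ultimately show ?thesis by (simp add: compact_Int_closed)
  qed
  moreover have "F n \<noteq> {}" for n
  proof -
    obtain a b where a: "p + a \<in> affine hull (insert p (N n))" "a \<noteq> 0" "a \<bullet> p \<le> b"
      "\<And>q. q \<in> N n \<Longrightarrow> b \<le> a \<bullet> q"
      by (rule separating_hyperplane_set_point_inaff[OF N(1,2,4)[of n]]) (rule that; assumption)
    have "affine hull (insert p (N n)) \<subseteq> V"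
      by (intro hull_minimal) (use assms(2) N(3) subspace_imp_affine[OF assms(1)] in auto)
    then have "(p + a) - p \<in> V"
      using a(1) assms(1,2) by (intro subspace_diff) auto
    then have "a \<in> V" by simp
    \<comment> \<open>The sign is changed because \<open>a\<close> is smaller on \<open>p\<close> than on \<open>N n\<close>.\<close>
    then have "(- (1 / norm a)) *\<^sub>R a \<in> V" by (rule subspace_scale[OF assms(1)])
    moreover have "(- (1 / norm a) *\<^sub>R a) \<bullet> q \<le> (- (1 / norm a) *\<^sub>R a) \<bullet> p" if "q \<in> N n" for q
    proof -
      have "a \<bullet> p \<le> a \<bullet> q" using a(3) a(4)[OF that] by linarith
      then show ?thesis using a(2) by (simp add: divide_right_mono)
    qed
    ultimately have "(- (1 / norm a)) *\<^sub>R a \<in> F n" using a(2) by (simp add: F_def)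
    then show ?thesis by blast
  qed
  moreover have "F n \<subseteq> F m" if "m \<le> n" for m n
    using mono[OF that] by (auto simp: F_def)
  ultimately have "\<Inter>(range F) \<noteq> {}" by (rule compact_nest)
  then obtain a where "\<And>n. a \<in> F n" by auto
  then show thesis by (intro that[of a]) (auto simp: F_def)
qed

text \<open>The equality case of the Cauchy--Schwarz inequality: expand the square of the distance between
  \<open>u\<close> and \<open>sgn x\<close>.\<close>

lemma eq_sgn_if_inner_maximal:
  fixes x u :: "'a::real_inner"
  assumes "x \<noteq> 0" "norm u \<le> 1" "norm x \<le> x \<bullet> u"
  shows "u = sgn x"
proof -
  have "1 \<le> sgn x \<bullet> u"
  proof -
    have "sgn x \<bullet> u = (x \<bullet> u) / norm x"
      by (simp add: sgn_div_norm divide_inverse mult.commute)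
    then show ?thesis using assms(1,3) by (simp add: le_divide_eq)
  qed
  moreover have "sgn x \<bullet> sgn x = 1"
    using assms(1) by (simp add: norm_sgn flip: power2_norm_eq_inner)
  then have "(norm (u - sgn x))\<^sup>2 = (norm u)\<^sup>2 - 2 * (sgn x \<bullet> u) + 1"
    unfolding power2_norm_eq_inner inner_diff by (simp add: inner_commute)
  moreover have "(norm u)\<^sup>2 \<le> 1"
    using assms(2) by (simp add: power_le_one)
  ultimately have "(norm (u - sgn x))\<^sup>2 \<le> 0" by linarith
  then show ?thesis by simp
qed

section \<open>Integrals of bounded functions with finitely many discontinuities\<close>

text \<open>The assumptions only concern the open interval, because a control may oscillate near time \<open>0\<close>.\<close>

lemma integrable_finite_discontinuities:
  fixes g :: "real \<Rightarrow> 'a::euclidean_space"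
  assumes "finite {t. a < t \<and> t < b \<and> \<not> isCont g t}" (is "finite ?D")
    and "\<And>t. a < t \<Longrightarrow> t < b \<Longrightarrow> norm (g t) \<le> C"
  shows "g integrable_on {a..b}"
proof -
  define S where "S = {a<..<b} - ?D"
  have "open S" unfolding S_def by (intro open_Diff open_greaterThanLessThan finite_imp_closed assms)
  moreover have "bounded S" unfolding S_def by (rule bounded_subset[of "{a..b}"]) auto
  ultimately have S: "S \<in> lmeasurable" by (rule lmeasurable_open[rotated])
  have "continuous_on S g"
    using \<open>open S\<close> by (auto simp: continuous_on_eq_continuous_at S_def)
  then have "g \<in> borel_measurable (lebesgue_on S)"
    using S by (intro continuous_imp_measurable_on_sets_lebesgue) auto
  moreover have "(\<lambda>_. C) integrable_on S" using S by (rule integrable_on_const)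
  moreover have "norm (g t) \<le> C" if "t \<in> S" for t
    using that assms(2) by (simp add: S_def)
  ultimately have "g integrable_on S"
    by (rule measurable_bounded_by_integrable_imp_integrable[OF _ _ _ fmeasurableD[OF S]])
  then show ?thesis
  proof (rule integrable_spike_set)
    show "negligible {x \<in> S - {a..b}. g x \<noteq> 0}"
      by (rule negligible_subset[of "{}"]) (auto simp: S_def)
    show "negligible {x \<in> {a..b} - S. g x \<noteq> 0}"
      by (rule negligible_subset[of "?D \<union> {a, b}"]) (use assms(1) in \<open>auto simp: S_def negligible_finite\<close>)
  qed
qed

text \<open>The component of the integral orthogonal to \<open>V\<close> is orthogonal to every value of the integrand,
  hence to the integral and to itself.\<close>

lemma integral_in_subspace:
  fixes g :: "real \<Rightarrow> 'a::euclidean_space"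
  assumes "subspace V" "g integrable_on S" "\<And>t. t \<in> S \<Longrightarrow> g t \<in> V"
  shows "integral S g \<in> V"
proof -
  obtain p q where p: "p \<in> span V" and q: "\<And>v. v \<in> span V \<Longrightarrow> orthogonal q v"
    and pq: "integral S g = p + q"
    using orthogonal_subspace_decomp_exists[of V "integral S g"] by metis
  have "q \<bullet> integral S g = integral S (\<lambda>t. q \<bullet> g t)"
    using integral_linear[OF assms(2) bounded_linear_inner_right[of q]] by (simp add: o_def)
  also have "\<dots> = integral S (\<lambda>t. 0)"
    by (rule integral_cong) (use q assms(3) in \<open>auto simp: orthogonal_def span_base\<close>)
  finally have "q \<bullet> q = 0"
    using q[OF p] by (simp add: pq inner_add_right orthogonal_def)
  then show ?thesis using p pq by (simp add: span_eq_iff[THEN iffD2, OF assms(1)])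
qed

section \<open>Piecewise continuous controls\<close>

lemma PC_const: "e \<in> E \<Longrightarrow> (\<lambda>_. e) \<in> PC E"
  by (auto simp: PC_def)

text \<open>Switching from \<open>u\<close> to \<open>w\<close> at time \<open>s\<close>. The value at \<open>s\<close> is the one of \<open>u\<close>, which keeps the result left
  continuous.\<close>

lemma PC_splice:
  assumes u: "u \<in> PC E" and w: "w \<in> PC E"
  shows "(\<lambda>t. if t \<le> s then u t else w t) \<in> PC E" (is "?v \<in> _")
proof -
  have near: "\<forall>\<^sub>F r in nhds t. ?v r = u r" if "t < s" for t
    by (rule eventually_mono[OF eventually_nhds_in_open[of "{..<s}"]]) (use that in auto)
  have near': "\<forall>\<^sub>F r in nhds t. ?v r = w r" if "s < t" for t
    by (rule eventually_mono[OF eventually_nhds_in_open[of "{s<..}"]]) (use that in auto)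
  have "isCont ?v t" if "isCont u t" "t < s" for t
    using that isCont_cong[OF near] by blast
  moreover have "isCont ?v t" if "isCont w t" "s < t" for t
    using that isCont_cong[OF near'] by blast
  ultimately have "{t. 0 < t \<and> \<not> isCont ?v t} \<subseteq>
      insert s ({t. 0 < t \<and> \<not> isCont u t} \<union> {t. 0 < t \<and> \<not> isCont w t})"
    by (auto simp: not_less_iff_gr_or_eq) (metis linorder_neqE)+
  moreover have "finite (insert s ({t. 0 < t \<and> \<not> isCont u t} \<union> {t. 0 < t \<and> \<not> isCont w t}))"
    using u w by (simp add: PC_def)
  ultimately have "finite {t. 0 < t \<and> \<not> isCont ?v t}" by (rule finite_subset)
  moreover have "(?v \<longlongrightarrow> ?v t) (at_left t)" if "0 < t" for t
  proof (cases "t \<le> s")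
    case True
    then have "\<forall>\<^sub>F r in at_left t. ?v r = u r"
      unfolding eventually_at_filter by (intro always_eventually) auto
    moreover have "(u \<longlongrightarrow> u t) (at_left t)" using u that by (simp add: PC_def)
    ultimately show ?thesis using True by (simp add: tendsto_cong)
  next
    case False
    then have "\<forall>\<^sub>F r in at_left t. ?v r = w r"
      unfolding eventually_at_filter by (intro eventually_mono[OF near']) auto
    moreover have "(w \<longlongrightarrow> w t) (at_left t)" using w that by (simp add: PC_def)
    ultimately show ?thesis using False by (simp add: tendsto_cong)
  qed
  moreover have "\<exists>l. (?v \<longlongrightarrow> l) (at_right t)" if "0 < t" for t
  proof (cases "t < s")
    case True
    then have "\<forall>\<^sub>F r in at_right t. ?v r = u r"
      unfolding eventually_at_filter by (intro eventually_mono[OF near]) auto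
    moreover have "\<exists>l. (u \<longlongrightarrow> l) (at_right t)" using u that by (simp add: PC_def)
    ultimately show ?thesis by (simp add: tendsto_cong)
  next
    case False
    then have "\<forall>\<^sub>F r in at_right t. ?v r = w r"
      unfolding eventually_at_filter by (intro always_eventually) auto
    moreover have "\<exists>l. (w \<longlongrightarrow> l) (at_right t)" using w that by (simp add: PC_def)
    ultimately show ?thesis by (simp add: tendsto_cong)
  qed
  ultimately show ?thesis using u w by (auto simp: PC_def)
qed

lemma PC_convex_combination:
  fixes u w :: "real \<Rightarrow> 'a::real_normed_vector"
  assumes u: "u \<in> PC E" and w: "w \<in> PC E" and E: "convex E" and "0 \<le> a" "0 \<le> b" "a + b = 1"
  shows "(\<lambda>t. a *\<^sub>R u t + b *\<^sub>R w t) \<in> PC E" (is "?v \<in> _")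
proof -
  have "isCont ?v t" if "isCont u t" "isCont w t" for t
    using that by (intro continuous_intros)
  then have "{t. 0 < t \<and> \<not> isCont ?v t} \<subseteq> {t. 0 < t \<and> \<not> isCont u t} \<union> {t. 0 < t \<and> \<not> isCont w t}"
    by auto
  moreover have "finite ({t. 0 < t \<and> \<not> isCont u t} \<union> {t. 0 < t \<and> \<not> isCont w t})"
    using u w by (simp add: PC_def)
  ultimately have "finite {t. 0 < t \<and> \<not> isCont ?v t}" by (rule finite_subset)
  moreover have "?v t \<in> E" if "0 < t" for t
    using that u w assms(4-6) by (intro convexD[OF E]) (auto simp: PC_def)
  moreover have "(?v \<longlongrightarrow> ?v t) (at_left t)" if "0 < t" for t
    using that u w by (intro tendsto_intros) (auto simp: PC_def)
  moreover have "\<exists>l. (?v \<longlongrightarrow> l) (at_right t)" if t: "0 < t" for t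
  proof -
    obtain l l' where "(u \<longlongrightarrow> l) (at_right t)" "(w \<longlongrightarrow> l') (at_right t)"
      using t u w unfolding PC_def by blast
    then have "(?v \<longlongrightarrow> a *\<^sub>R l + b *\<^sub>R l') (at_right t)" by (intro tendsto_intros)
    then show ?thesis by blast
  qed
  ultimately show ?thesis by (auto simp: PC_def)
qed

section \<open>Steering to zero as an integral condition\<close>

text \<open>The rate of change of \<open>e\<^bsup>-tA\<^esup> x(t)\<close> along a trajectory \<open>x\<close> of the control system. In these
  coordinates the free motion disappears, so that the target \<open>0\<close> is reached at time \<open>T\<close> if and only
  if this rate integrates to \<open>-x0\<close> over \<open>[0, T]\<close>.\<close>

definition pullback_input :: "real^'n^'n \<Rightarrow> real^'m^'n \<Rightarrow> (real \<Rightarrow> real^'m) \<Rightarrow> real \<Rightarrow> real^'n" where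
  "pullback_input A B u s = mexp A (- s) *v (B *v u s)"

lemma isCont_pullback_input:
  assumes "isCont u t"
  shows "isCont (pullback_input A B u) t"
proof -
  have "isCont (\<lambda>s. mexp A (- s)) t"
    by (rule has_vector_derivative_continuous[OF mexp_minus_has_vector_derivative])
  moreover have "isCont (\<lambda>s. B *v u s) t"
    by (rule bounded_linear.isCont[OF matrix_vector_mul_bounded_linear assms])
  ultimately show ?thesis
    unfolding pullback_input_def
    by (rule bounded_bilinear.isCont[OF bounded_bilinear_matrix_vector_mult])
qed

lemma pullback_input_integrable:
  fixes A :: "real^'n^'n" and B :: "real^'m^'n"
  assumes "u \<in> PC (cball 0 1)"
  shows "pullback_input A B u integrable_on {0..T}"
proof -
  have "continuous_on {0..T} (\<lambda>s. mexp A (- s))"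
    by (intro continuous_at_imp_continuous_on ballI
        has_vector_derivative_continuous[OF mexp_minus_has_vector_derivative])
  then have "bounded ((\<lambda>s. mexp A (- s)) ` {0..T})"
    by (intro compact_imp_bounded compact_continuous_image) auto
  then obtain C where C: "\<And>s. s \<in> {0..T} \<Longrightarrow> norm (mexp A (- s)) \<le> C"
    unfolding bounded_iff by blast
  obtain K where K: "K \<ge> 0" "\<forall>(X::real^'n^'n) x. norm (X *v x) \<le> norm X * norm x * K"
    using bounded_bilinear.nonneg_bounded[OF bounded_bilinear_matrix_vector_mult[where 'n = 'n and 'm = 'n]]
    by (elim exE conjE) (rule that)
  obtain L where L: "L \<ge> 0" "\<forall>y. norm (B *v y) \<le> norm y * L"
    using bounded_linear.nonneg_bounded[OF matrix_vector_mul_bounded_linear[of B]]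
    by (elim exE conjE) (rule that)
  show ?thesis
  proof (rule integrable_finite_discontinuities)
    have "finite {t. 0 < t \<and> \<not> isCont u t}" using assms by (simp add: PC_def)
    moreover have "{t. 0 < t \<and> t < T \<and> \<not> isCont (pullback_input A B u) t} \<subseteq> {t. 0 < t \<and> \<not> isCont u t}"
      using isCont_pullback_input by blast
    ultimately show "finite {t. 0 < t \<and> t < T \<and> \<not> isCont (pullback_input A B u) t}"
      by (rule finite_subset[rotated])
    fix t assume t: "0 < t" "t < T"
    have "norm (u t) \<le> 1" using assms t by (simp add: PC_def)
    then have "norm (B *v u t) \<le> 1 * L"
      using L by (meson mult_right_mono order_trans)
    moreover have "norm (mexp A (- t)) \<le> C" using C t by simp
    moreover have "0 \<le> C" using calculation(2) norm_ge_zero order_trans by blast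
    ultimately have "norm (mexp A (- t)) * norm (B *v u t) * K \<le> C * (1 * L) * K"
      using K(1) by (intro mult_right_mono mult_mono) auto
    then show "norm (pullback_input A B u t) \<le> C * (1 * L) * K"
      unfolding pullback_input_def using K(2) by (meson order_trans)
  qed
qed

text \<open>From left to right this is the fundamental theorem of calculus for \<open>e\<^bsup>-tA\<^esup> x(t)\<close>, whose finitely many
  points of nondifferentiability are harmless. From right to left, variation of constants gives the
  trajectory.\<close>

lemma steers_to_zero_iff:
  fixes A :: "real^'n^'n" and B :: "real^'m^'n"
  assumes u: "u \<in> PC (cball 0 1)" and T: "0 \<le> T"
  shows "steers_to_zero A B x0 u T \<longleftrightarrow> integral {0..T} (pullback_input A B u) = - x0"
proof
  interpret M: bounded_bilinear "\<lambda>(A::real^'n^'n) x. A *v x"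
    by (rule bounded_bilinear_matrix_vector_mult)
  assume "steers_to_zero A B x0 u T"
  then obtain x where x: "continuous_on {0..} x" "x 0 = x0" "x T = 0"
    "\<And>t. t > 0 \<Longrightarrow> isCont u t \<Longrightarrow> (x has_vector_derivative (A *v x t + B *v u t)) (at t)"
    unfolding steers_to_zero_def is_solution_def by blast
  let ?y = "\<lambda>t. mexp A (- t) *v x t"
  have "(pullback_input A B u has_integral (?y T - ?y 0)) {0..T}"
  proof (rule fundamental_theorem_of_calculus_interior_strong[where S = "{t. 0 < t \<and> \<not> isCont u t}"])
    show "finite {t. 0 < t \<and> \<not> isCont u t}" using u by (simp add: PC_def)
    show "0 \<le> T" by (rule T)
    show "continuous_on {0..T} ?y"
    proof (rule M.continuous_on)
      show "continuous_on {0..T} (\<lambda>s. mexp A (- s))"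
        by (intro continuous_at_imp_continuous_on ballI
            has_vector_derivative_continuous[OF mexp_minus_has_vector_derivative])
      show "continuous_on {0..T} x" using x(1) by (rule continuous_on_subset) auto
    qed
    fix t assume t: "t \<in> {0<..<T} - {t. 0 < t \<and> \<not> isCont u t}"
    have "(?y has_vector_derivative (mexp A (- t) *v (A *v x t + B *v u t) + (- (A ** mexp A (- t))) *v x t)) (at t)"
      using t by (intro M.has_vector_derivative mexp_minus_has_vector_derivative x(4)) auto
    moreover have "mexp A (- t) *v (A *v x t + B *v u t) + (- (A ** mexp A (- t))) *v x t
        = pullback_input A B u t"
      by (simp add: pullback_input_def M.add_right M.minus_left matrix_vector_mul_assoc mexp_commute)
    ultimately show "(?y has_vector_derivative pullback_input A B u t) (at t)" by simp
  qed
  then show "integral {0..T} (pullback_input A B u) = - x0"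
    using x(2,3) by (simp add: mexp_0 integral_unique)
next
  interpret M: bounded_bilinear "\<lambda>(A::real^'n^'n) x. A *v x"
    by (rule bounded_bilinear_matrix_vector_mult)
  let ?f = "pullback_input A B u"
  assume eq: "integral {0..T} ?f = - x0"
  define x where "x t = mexp A t *v (x0 + integral {0..t} ?f)" for t
  have "continuous_on {0..} x"
  proof -
    have "continuous_on {0..} (\<lambda>t. integral {0..t} ?f)"
      unfolding continuous_on_eq_continuous_within
    proof
      fix t :: real assume t: "t \<in> {0..}"
      have "continuous_on {0..t+1} (\<lambda>t. integral {0..t} ?f)"
        by (intro indefinite_integral_continuous_1 pullback_input_integrable u)
      then have "continuous (at t within {0..t+1}) (\<lambda>t. integral {0..t} ?f)"
        using t by (simp add: continuous_on_eq_continuous_within)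
      moreover have "at t within {0..t+1} = at t within {0..}"
        by (rule at_within_nhd[of _ "{..<t+1}"]) auto
      ultimately show "continuous (at t within {0..}) (\<lambda>t. integral {0..t} ?f)" by simp
    qed
    moreover have "continuous_on {0..} (\<lambda>s. mexp A s)"
      by (intro continuous_at_imp_continuous_on ballI
          has_vector_derivative_continuous[OF mexp_has_vector_derivative])
    ultimately show ?thesis
      unfolding x_def by (intro M.continuous_on continuous_on_add continuous_on_const)
  qed
  moreover have "x 0 = x0" by (simp add: x_def mexp_0)
  moreover have "x T = 0" by (simp add: x_def eq)
  moreover have "(x has_vector_derivative (A *v x t + B *v u t)) (at t)" if t: "t > 0" "isCont u t" for t
  proof -
    have "((\<lambda>t. integral {0..t} ?f) has_vector_derivative ?f t) (at t within ({0..t+1} - {}))"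
      by (rule integral_has_vector_derivative_continuous_at[OF pullback_input_integrable[OF u] _ _
            continuous_at_imp_continuous_at_within[OF isCont_pullback_input[OF t(2)]]])
        (use t in auto)
    moreover have "at t within ({0..t+1} - {}) = at t"
      by (rule at_within_interior) (use t(1) in \<open>simp\<close>)
    ultimately have "((\<lambda>t. integral {0..t} ?f) has_vector_derivative ?f t) (at t)"
      by simp
    from has_vector_derivative_add[OF has_vector_derivative_const[of x0] this]
    have "((\<lambda>t. x0 + integral {0..t} ?f) has_vector_derivative ?f t) (at t)"
      by simp
    then have "(x has_vector_derivative
        (mexp A t *v ?f t + (A ** mexp A t) *v (x0 + integral {0..t} ?f))) (at t)"
      unfolding x_def by (intro M.has_vector_derivative mexp_has_vector_derivative)
    moreover have "mexp A t *v ?f t = B *v u t"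
      by (simp add: pullback_input_def matrix_vector_mul_assoc matrix_mul_assoc mexp_mult_mexp_minus)
    moreover have "(A ** mexp A t) *v (x0 + integral {0..t} ?f) = A *v x t"
      by (simp add: x_def matrix_vector_mul_assoc)
    ultimately show ?thesis by (simp add: add.commute)
  qed
  ultimately show "steers_to_zero A B x0 u T"
    unfolding steers_to_zero_def is_solution_def by blast
qed

section \<open>The controllable subspace\<close>

text \<open>All powers of \<open>A\<close> are used, instead of the first \<open>n\<close>, so that invariance under \<open>A\<close> is immediate.\<close>

definition controllable_subspace :: "real^'n^'n \<Rightarrow> real^'m^'n \<Rightarrow> (real^'n) set" where
  "controllable_subspace A B = span (\<Union>i. range (\<lambda>y. matpow A i *v (B *v y)))"

lemma subspace_controllable_subspace: "subspace (controllable_subspace A B)"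
  by (simp add: controllable_subspace_def)

lemma controllable_subspace_generator: "matpow A i *v (B *v y) \<in> controllable_subspace A B"
  unfolding controllable_subspace_def by (rule span_base) blast

lemma controllable_subspace_subset:
  assumes "subspace V" "\<And>i y. matpow A i *v (B *v y) \<in> V"
  shows "controllable_subspace A B \<subseteq> V"
  unfolding controllable_subspace_def by (intro span_minimal assms) (use assms(2) in blast)

lemma controllable_subspace_invariant:
  assumes "v \<in> controllable_subspace A B"
  shows "A *v v \<in> controllable_subspace A B"
proof -
  have "subspace {v. A *v v \<in> controllable_subspace A B}"
    using linear_subspace_vimage[OF matrix_vector_mul_linear[of A] subspace_controllable_subspace]
    by (simp add: vimage_def)
  moreover have "matpow A i *v (B *v y) \<in> {v. A *v v \<in> controllable_subspace A B}" for i y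
    using controllable_subspace_generator[of A "Suc i" B y] by (simp flip: matrix_vector_mul_assoc)
  ultimately have "controllable_subspace A B \<subseteq> {v. A *v v \<in> controllable_subspace A B}"
    by (rule controllable_subspace_subset)
  then show ?thesis using assms by blast
qed

lemma mexp_controllable_subspace:
  "v \<in> controllable_subspace A B \<Longrightarrow> mexp A t *v v \<in> controllable_subspace A B"
  by (rule mexp_invariant_subspace[OF subspace_controllable_subspace controllable_subspace_invariant])

lemma pullback_input_in_controllable_subspace:
  "pullback_input A B u t \<in> controllable_subspace A B"
  unfolding pullback_input_def
  using mexp_controllable_subspace[OF controllable_subspace_generator[of A 0 B]] by simp

section \<open>The maximum principle\<close>

text \<open>The set of all \<open>-x0\<close> such that \<open>x0\<close> can be steered to \<open>0\<close> in time \<open>T\<close>. In the pulled-back coordinates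
  these sets increase with \<open>T\<close>.\<close>

definition pullback_reach :: "real^'n^'n \<Rightarrow> real^'m^'n \<Rightarrow> real \<Rightarrow> (real^'n) set" where
  "pullback_reach A B T = (\<lambda>u. integral {0..T} (pullback_input A B u)) ` PC (cball 0 1)"

lemma pullback_reach_subset: "pullback_reach A B T \<subseteq> controllable_subspace A B"
  unfolding pullback_reach_def
  using integral_in_subspace[OF subspace_controllable_subspace pullback_input_integrable
      pullback_input_in_controllable_subspace] by blast

lemma convex_pullback_reach: "convex (pullback_reach A B T)"
proof (rule convexI)
  fix p q and a b :: real
  assume "p \<in> pullback_reach A B T" "q \<in> pullback_reach A B T" and ab: "0 \<le> a" "0 \<le> b" "a + b = 1"
  then obtain u w where u: "u \<in> PC (cball 0 1)" "p = integral {0..T} (pullback_input A B u)"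
    and w: "w \<in> PC (cball 0 1)" "q = integral {0..T} (pullback_input A B w)"
    unfolding pullback_reach_def by blast
  have "pullback_input A B (\<lambda>t. a *\<^sub>R u t + b *\<^sub>R w t)
      = (\<lambda>t. a *\<^sub>R pullback_input A B u t + b *\<^sub>R pullback_input A B w t)"
    by (simp add: pullback_input_def matrix_vector_right_distrib matrix_vector_mult_scaleR fun_eq_iff)
  moreover have "integral {0..T} (\<lambda>t. a *\<^sub>R pullback_input A B u t + b *\<^sub>R pullback_input A B w t) = a *\<^sub>R p + b *\<^sub>R q"
    unfolding u(2) w(2)
    by (simp add: integral_add integrable_cmul pullback_input_integrable u(1) w(1))
  moreover have "(\<lambda>t. a *\<^sub>R u t + b *\<^sub>R w t) \<in> PC (cball 0 1)"
    by (rule PC_convex_combination[OF u(1) w(1) convex_cball ab])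
  ultimately show "a *\<^sub>R p + b *\<^sub>R q \<in> pullback_reach A B T"
    unfolding pullback_reach_def by (intro image_eqI[of _ _ "\<lambda>t. a *\<^sub>R u t + b *\<^sub>R w t"]) simp_all
qed

text \<open>The control is continued by zero.\<close>

lemma pullback_reach_mono:
  assumes "0 \<le> s" "s \<le> t"
  shows "pullback_reach A B s \<subseteq> pullback_reach A B t"
proof
  fix p assume "p \<in> pullback_reach A B s"
  then obtain u where u: "u \<in> PC (cball 0 1)" "p = integral {0..s} (pullback_input A B u)"
    unfolding pullback_reach_def by blast
  let ?v = "\<lambda>r. if r \<le> s then u r else 0"
  have v: "?v \<in> PC (cball 0 1)"
    by (rule PC_splice[OF u(1) PC_const]) simp
  have "integral {0..t} (pullback_input A B ?v)
      = integral {0..s} (pullback_input A B ?v) + integral {s..t} (pullback_input A B ?v)"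
    by (rule Henstock_Kurzweil_Integration.integral_combine[symmetric]) (rule assms pullback_input_integrable v)+
  also have "integral {0..s} (pullback_input A B ?v) = p"
    unfolding u(2) by (rule integral_cong) (simp add: pullback_input_def)
  also have "integral {s..t} (pullback_input A B ?v) = integral {s..t} (\<lambda>_. 0)"
    by (rule integral_spike[of "{s}"]) (auto simp: pullback_input_def)
  finally have "p = integral {0..t} (pullback_input A B ?v)" by simp
  then show "p \<in> pullback_reach A B t"
    unfolding pullback_reach_def using v by blast
qed

lemma steers_iff_pullback_reach:
  assumes "0 \<le> T"
  shows "(\<exists>u\<in>PC (cball 0 1). steers_to_zero A B x0 u T) \<longleftrightarrow> - x0 \<in> pullback_reach A B T"
  unfolding pullback_reach_def image_iff
  by (rule bex_cong[OF refl], subst steers_to_zero_iff[OF _ assms]) auto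

text \<open>By optimality \<open>-x0\<close> lies outside the convex set \<open>pullback_reach A B s\<close> for every \<open>s\<close> before \<open>T\<close>, so
  these increasing sets have a common direction \<open>a\<close> of separation from \<open>-x0\<close>, and the inequality extends to
  time \<open>T\<close> by continuity of the integral in its upper limit. Taking \<open>a\<close> in the controllable subspace
  is what makes the conclusion nontrivial when the system is not controllable.\<close>

lemma maximum_principle:
  fixes A :: "real^'n^'n" and B :: "real^'m^'n"
  assumes T: "T = optimal_time A B x0" "0 < T"
    and us: "us \<in> PC (cball 0 1)" "steers_to_zero A B x0 us T"
  obtains a where "a \<in> controllable_subspace A B" "a \<noteq> 0"
    "\<And>u. u \<in> PC (cball 0 1) \<Longrightarrow>
       a \<bullet> integral {0..T} (pullback_input A B u) \<le> a \<bullet> integral {0..T} (pullback_input A B us)"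
proof -
  \<comment> \<open>The offset \<open>2\<close> keeps all times of this sequence strictly positive.\<close>
  define s where "s n = T - T / real (n + 2)" for n
  have s: "0 < s n" "s n < T" for n
  proof -
    have "T * 1 < T * real (n + 2)" using T(2) by (intro mult_strict_left_mono) auto
    then show "0 < s n" by (simp add: s_def divide_less_eq)
    show "s n < T" using T(2) by (simp add: s_def)
  qed
  have s_mono: "s m \<le> s n" if "m \<le> n" for m n
    using that T(2) by (auto simp: s_def intro!: divide_left_mono)
  have "(\<lambda>n. T - T / real (n + 2)) \<longlonglongrightarrow> T - 0"
    by (intro tendsto_diff tendsto_const LIMSEQ_ignore_initial_segment[OF lim_const_over_n])
  then have s_lim: "s \<longlonglongrightarrow> T" by (simp add: s_def[abs_def])
  have x0: "integral {0..T} (pullback_input A B us) = - x0"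
    using iffD1[OF steers_to_zero_iff[OF us(1)] us(2)] T(2) by simp
  show thesis
  proof (rule common_supporting_direction[of "controllable_subspace A B" "- x0" "\<lambda>n. pullback_reach A B (s n)"])
    show "subspace (controllable_subspace A B)" by (rule subspace_controllable_subspace)
    show "- x0 \<in> controllable_subspace A B"
      using pullback_reach_subset[of A B T] us(1) unfolding x0[symmetric] pullback_reach_def by blast
    show "convex (pullback_reach A B (s n))" for n by (rule convex_pullback_reach)
    show "pullback_reach A B (s n) \<noteq> {}" for n
      unfolding pullback_reach_def using us(1) by blast
    show "pullback_reach A B (s n) \<subseteq> controllable_subspace A B" for n
      by (rule pullback_reach_subset)
    show "- x0 \<notin> pullback_reach A B (s n)" for n
    proof
      assume "- x0 \<in> pullback_reach A B (s n)"
      then have "\<exists>u\<in>PC (cball 0 1). steers_to_zero A B x0 u (s n)"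
        using steers_iff_pullback_reach[of "s n" A B x0] s(1)[of n] by simp
      then have "optimal_time A B x0 \<le> s n"
        unfolding optimal_time_def using s(1)[of n]
        by (intro cInf_lower bdd_belowI[of _ 0]) auto
      then show False using s(2)[of n] T(1) by simp
    qed
    show "pullback_reach A B (s m) \<subseteq> pullback_reach A B (s n)" if "m \<le> n" for m n
      by (rule pullback_reach_mono) (use s(1)[of m] s_mono[OF that] in auto)
    fix a assume a: "a \<in> controllable_subspace A B" "a \<noteq> 0"
      "\<And>n q. q \<in> pullback_reach A B (s n) \<Longrightarrow> a \<bullet> q \<le> a \<bullet> - x0"
    show thesis
    proof (rule that[OF a(1,2)])
      fix u :: "real \<Rightarrow> real^'m" assume u: "u \<in> PC (cball 0 1)"
      let ?I = "\<lambda>t. integral {0..t} (pullback_input A B u)"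
      have "continuous_on {0..T} ?I"
        by (intro indefinite_integral_continuous_1 pullback_input_integrable u)
      then have "(\<lambda>n. ?I (s n)) \<longlonglongrightarrow> ?I T"
        by (rule continuous_on_tendsto_compose[OF _ s_lim])
          (use s T(2) in \<open>auto intro!: always_eventually less_imp_le\<close>)
      then have "(\<lambda>n. a \<bullet> ?I (s n)) \<longlonglongrightarrow> a \<bullet> ?I T" by (intro tendsto_intros)
      moreover have "a \<bullet> ?I (s n) \<le> a \<bullet> - x0" for n
        by (rule a(3)[of _ n]) (use u in \<open>auto simp: pullback_reach_def\<close>)
      ultimately have "a \<bullet> ?I T \<le> a \<bullet> - x0" by (intro LIMSEQ_le_const2) auto
      then show "a \<bullet> ?I T \<le> a \<bullet> integral {0..T} (pullback_input A B us)" by (simp add: x0)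
    qed
  qed
qed

section \<open>The switching function\<close>

text \<open>The solution of the adjoint equation \<open>p' = -A\<^sup>T p\<close> with initial value \<open>a\<close>. The function
  \<open>B\<^sup>T p\<close> is the switching function.\<close>

definition costate :: "real^'n^'n \<Rightarrow> real^'n \<Rightarrow> real \<Rightarrow> real^'n" where
  "costate A a t = transpose (mexp A (- t)) *v a"

lemma inner_pullback_input:
  "a \<bullet> pullback_input A B u t = (transpose B *v costate A a t) \<bullet> u t"
  unfolding pullback_input_def costate_def by (simp only: inner_matrix_vector_mult)

lemma costate_has_vector_derivative:
  fixes A :: "real^'n^'n"
  shows "(costate A a has_vector_derivative - (transpose A *v costate A a t)) (at t)"
proof -
  have "bounded_linear (\<lambda>X::real^'n^'n. transpose X *v a)"
    unfolding linear_conv_bounded_linear[symmetric]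
    by (intro linearI) (simp_all add: vec_eq_iff matrix_vector_mult_def transpose_def sum_distrib_left sum.distrib algebra_simps del: transpose_matrix_vector)
  from bounded_linear.has_vector_derivative[OF this mexp_minus_has_vector_derivative[of A t UNIV]]
  have "(costate A a has_vector_derivative transpose (- (A ** mexp A (- t))) *v a) (at t)"
    unfolding costate_def[abs_def] .
  moreover have "transpose (- (A ** mexp A (- t))) *v a = - (transpose (mexp A (- t) ** A) *v a)"
    unfolding mexp_commute
    by (simp add: vec_eq_iff matrix_vector_mult_def transpose_def sum_negf del: transpose_matrix_vector)
  ultimately show ?thesis
    by (simp only: matrix_transpose_mul costate_def matrix_vector_mul_assoc)
qed

text \<open>Otherwise \<open>costate A a t\<close> is orthogonal to the controllable subspace, in particular to
  \<open>e\<^bsup>tA\<^esup> a\<close>; but that inner product is \<open>a \<bullet> a\<close>.\<close>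

lemma costate_detected:
  fixes A :: "real^'n^'n" and B :: "real^'m^'n"
  assumes "a \<in> controllable_subspace A B" "a \<noteq> 0"
  shows "\<exists>i. (transpose B ** matpow (transpose A) i) *v costate A a t \<noteq> 0"
proof (rule ccontr)
  assume "\<nexists>i. (transpose B ** matpow (transpose A) i) *v costate A a t \<noteq> 0"
  then have "costate A a t \<bullet> (matpow A i *v (B *v y)) = 0" for i y
    unfolding inner_matpow_mult by simp
  then have "controllable_subspace A B \<subseteq> {x. costate A a t \<bullet> x = 0}"
    by (intro controllable_subspace_subset subspace_hyperplane) simp
  then have "costate A a t \<bullet> (mexp A t *v a) = 0"
    using mexp_controllable_subspace[OF assms(1)] by blast
  also have "costate A a t \<bullet> (mexp A t *v a) = a \<bullet> (mexp A (- t) *v (mexp A t *v a))"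
    unfolding costate_def by (rule inner_matrix_vector_mult[symmetric])
  also have "\<dots> = a \<bullet> a"
    unfolding matrix_vector_mul_assoc mexp_minus_mult_mexp by simp
  finally show False using assms(2) by simp
qed

text \<open>If the control differs from the unit vector \<open>e\<close> in the direction of the switching function at a point
  of continuity, then replacing it by \<open>e\<close> on a short interval around this point strictly increases the
  maximal integral.\<close>

lemma optimal_control_eq_sgn:
  fixes A :: "real^'n^'n" and B :: "real^'m^'n"
  assumes us: "us \<in> PC (cball 0 1)"
    and max: "\<And>u. u \<in> PC (cball 0 1) \<Longrightarrow>
       a \<bullet> integral {0..T} (pullback_input A B u) \<le> a \<bullet> integral {0..T} (pullback_input A B us)"
    and t: "0 < t" "t < T" "isCont us t" and nz: "transpose B *v costate A a t \<noteq> 0"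
  shows "us t = sgn (transpose B *v costate A a t)"
proof (rule ccontr)
  assume neq: "us t \<noteq> sgn (transpose B *v costate A a t)"
  define \<phi> where "\<phi> s = transpose B *v costate A a s" for s
  define e where "e = sgn (\<phi> t)"
  define g where "g s = \<phi> s \<bullet> (e - us s)" for s
  have "norm (us t) \<le> 1" using us t(1) by (simp add: PC_def)
  then have "\<phi> t \<bullet> us t < norm (\<phi> t)"
    using eq_sgn_if_inner_maximal[of "\<phi> t" "us t"] neq nz by (force simp: \<phi>_def)
  moreover have "\<phi> t \<bullet> e = norm (\<phi> t)"
    using nz by (simp add: e_def \<phi>_def sgn_div_norm dot_square_norm power2_eq_square)
  ultimately have "0 < g t" by (simp add: g_def inner_diff_right)
  have "isCont (costate A a) t"
    by (rule has_vector_derivative_continuous[OF costate_has_vector_derivative])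
  then have "isCont \<phi> t"
    unfolding \<phi>_def[abs_def] by (rule bounded_linear.isCont[OF matrix_vector_mul_bounded_linear])
  then have "isCont g t"
    unfolding g_def[abs_def] by (intro continuous_intros t(3))
  then have "(g \<longlongrightarrow> g t) (nhds t)"
    unfolding isCont_def tendsto_at_iff_tendsto_nhds .
  then have "\<forall>\<^sub>F s in nhds t. g t / 2 < g s"
    by (rule order_tendstoD(1)) (use \<open>0 < g t\<close> in simp)
  then obtain \<delta> where \<delta>: "\<delta> > 0" "\<And>s. dist s t < \<delta> \<Longrightarrow> g t / 2 < g s"
    unfolding eventually_nhds_metric by blast
  \<comment> \<open>Small enough for the interval of radius \<open>r\<close> to stay inside \<open>(0, T)\<close> and where \<open>g\<close> exceeds \<open>g t / 2\<close>.\<close>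
  define r where "r = min (\<delta> / 2) (min (t / 2) ((T - t) / 2))"
  have r: "0 < r" "r < \<delta>" "r < t" "t + r < T"
    using \<delta>(1) t(1,2) by (auto simp: r_def min_def field_simps)
  define v where "v s = (if s \<le> t - r then us s else if s \<le> t + r then e else us s)" for s
  have "e \<in> cball 0 1" by (simp add: e_def norm_sgn)
  then have v: "v \<in> PC (cball 0 1)"
    unfolding v_def[abs_def] by (intro PC_splice us PC_const)
  define d where "d s = a \<bullet> (pullback_input A B v s - pullback_input A B us s)" for s
  have d: "d s = (if t - r < s \<and> s \<le> t + r then g s else 0)" for s
    by (auto simp: d_def inner_diff_right inner_pullback_input g_def v_def \<phi>_def)
  have g_ge: "g t / 2 < g s" if "t - r < s" "s \<le> t + r" for s
    using that r(2) by (intro \<delta>(2)) (auto simp: dist_real_def)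
  have d_int: "d integrable_on {0..T}"
    unfolding d_def[abs_def]
    using integrable_linear[OF integrable_diff[OF pullback_input_integrable[OF v] pullback_input_integrable[OF us]]
        bounded_linear_inner_right[of a]] by (simp add: o_def)
  have "integral {0..T} d = a \<bullet> (integral {0..T} (\<lambda>s. pullback_input A B v s - pullback_input A B us s))"
    unfolding d_def[abs_def]
    using integral_linear[OF integrable_diff[OF pullback_input_integrable[OF v] pullback_input_integrable[OF us]]
        bounded_linear_inner_right[of a]] by (simp add: o_def)
  also have "\<dots> \<le> 0"
    using max[OF v] by (simp add: integral_diff pullback_input_integrable v us inner_diff_right)
  finally have "integral {0..T} d \<le> 0" .
  have d_int': "d integrable_on {t..t + r}"
    by (rule integrable_on_subinterval[OF d_int]) (use t r in auto)
  \<comment> \<open>Only the right half \<open>[t, t + r]\<close> is used: it avoids the point \<open>t - r\<close>, at which the control is unchanged.\<close>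
  have "0 < r * (g t / 2)" using r \<open>0 < g t\<close> by simp
  also have "\<dots> = integral {t..t + r} (\<lambda>_. g t / 2)" using r by simp
  also have "\<dots> \<le> integral {t..t + r} d"
    using r g_ge by (intro integral_le d_int') (auto simp: d intro!: less_imp_le)
  also have "\<dots> \<le> integral {0..T} d"
  proof (rule integral_subset_le[OF _ d_int' d_int])
    show "{t..t + r} \<subseteq> {0..T}" using t r by auto
    have "0 \<le> d s" for s
      using g_ge[of s] \<open>0 < g t\<close> by (auto simp: d)
    then show "\<forall>s\<in>{0..T}. 0 \<le> d s" by blast
  qed
  finally show False using \<open>integral {0..T} d \<le> 0\<close> by simp
qed

section \<open>Switching points\<close>

text \<open>Near a zero of order \<open>k\<close> the function \<open>\<phi>\<close> behaves like \<open>(s - t)\<^sup>k c\<close>, and the sign of the scalar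
  factor is \<open>(-1)\<^sup>k\<close> on the left.\<close>

lemma sgn_direction_at_zero:
  fixes \<phi> u :: "real \<Rightarrow> 'a::real_normed_vector"
  assumes lim: "((\<lambda>s. \<phi> s /\<^sub>R (s - t) ^ k) \<longlongrightarrow> c) (at t)" "c \<noteq> 0"
    and u: "\<forall>\<^sub>F s in at t. \<phi> s \<noteq> 0 \<longrightarrow> u s = sgn (\<phi> s)"
  shows "(u \<longlongrightarrow> sgn c) (at_right t)" and "(u \<longlongrightarrow> (-1) ^ k *\<^sub>R sgn c) (at_left t)"
proof -
  let ?q = "\<lambda>s. \<phi> s /\<^sub>R (s - t) ^ k"
  have "\<forall>\<^sub>F s in at t. ?q s \<noteq> 0"
    using tendsto_imp_eventually_ne[OF lim] .
  with u have ev: "\<forall>\<^sub>F s in at t. u s = sgn (\<phi> s)"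
    by eventually_elim auto
  have sgn_lim: "((\<lambda>s. sgn (?q s)) \<longlongrightarrow> sgn c) (at t)"
    by (intro tendsto_sgn lim)
  have "\<forall>\<^sub>F s in at_right t. u s = sgn (\<phi> s)"
    using ev by (simp add: eventually_at_split)
  moreover have "\<forall>\<^sub>F s in at_right t. t < s" by (rule eventually_at_right_less)
  ultimately have "\<forall>\<^sub>F s in at_right t. sgn (?q s) = u s"
    by eventually_elim (simp add: sgn_scaleR)
  moreover have "((\<lambda>s. sgn (?q s)) \<longlongrightarrow> sgn c) (at_right t)"
    using sgn_lim by (simp add: filterlim_at_split)
  ultimately show "(u \<longlongrightarrow> sgn c) (at_right t)" by (rule Lim_transform_eventually[rotated])
  have "\<forall>\<^sub>F s in at_left t. u s = sgn (\<phi> s)"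
    using ev by (simp add: eventually_at_split)
  moreover have "\<forall>\<^sub>F s in at_left t. s < t" by (simp add: eventually_at_filter)
  ultimately have "\<forall>\<^sub>F s in at_left t. (-1) ^ k *\<^sub>R sgn (?q s) = u s"
  proof eventually_elim
    case (elim s)
    have "sgn ((s - t) ^ k) = (-1) ^ k" using elim(2) by (induction k) (simp_all add: sgn_mult)
    then show ?case using elim(1) by (simp add: sgn_scaleR sgn_inverse)
  qed
  moreover have "((\<lambda>s. sgn (?q s)) \<longlongrightarrow> sgn c) (at_left t)"
    using sgn_lim by (simp add: filterlim_at_split)
  then have "((\<lambda>s. (-1) ^ k *\<^sub>R sgn (?q s)) \<longlongrightarrow> (-1) ^ k *\<^sub>R sgn c) (at_left t)"
    by (rule tendsto_scaleR[OF tendsto_const])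
  ultimately show "(u \<longlongrightarrow> (-1) ^ k *\<^sub>R sgn c) (at_left t)" by (rule Lim_transform_eventually[rotated])
qed

text \<open>Let \<open>k\<close> be the order of the zero of the switching function at \<open>t\<close>, with \<open>k = 0\<close> if it does not vanish.
  For even \<open>k\<close> the one-sided limits of the control agree and there is no jump, so \<open>k\<close> is odd. Then
  the left limit is \<open>-1\<close> times the direction of the \<open>k\<close>-th derivative
  \<open>(-1)\<^sup>k B\<^sup>T (A\<^sup>T)\<^sup>k p\<close>, where \<open>p\<close> is the costate at \<open>t\<close>. The two signs cancel, and \<open>w\<close> is a positive
  multiple of \<open>p\<close>.\<close>

lemma switching_point_structure:
  fixes A :: "real^'n^'n" and B :: "real^'m^'n"
  assumes B: "B \<noteq> 0" and opt: "optimal_control A B x0 us" and t: "t \<in> switching_points A B x0 us"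
  obtains k w where "odd k" "k < CARD('n)"
    "\<And>i. i < k \<Longrightarrow> (transpose B ** matpow (transpose A) i) *v w = 0"
    "(us \<longlongrightarrow> (transpose B ** matpow (transpose A) k) *v w) (at_left t)"
proof -
  define T where "T = optimal_time A B x0"
  have t: "0 < t" "t < T" "\<not> isCont us t"
    using t by (auto simp: switching_points_def T_def)
  have us: "us \<in> PC (cball 0 1)" "steers_to_zero A B x0 us T"
    using opt by (auto simp: optimal_control_def T_def)
  have "0 < T" using t by simp
  from maximum_principle[OF T_def this us] obtain a
    where a: "a \<in> controllable_subspace A B" "a \<noteq> 0"
      and max: "\<And>u. u \<in> PC (cball 0 1) \<Longrightarrow>
        a \<bullet> integral {0..T} (pullback_input A B u) \<le> a \<bullet> integral {0..T} (pullback_input A B us)"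
    by metis
  define M where "M i = transpose B ** matpow (transpose A) i" for i
  define f where "f i s = (-1) ^ i *\<^sub>R (M i *v costate A a s)" for i s
  have f_deriv: "(f i has_vector_derivative f (Suc i) s) (at s)" for i s
  proof -
    have "bounded_linear (\<lambda>y. (-1) ^ i *\<^sub>R (M i *v y))"
      by (intro bounded_linear_intros matrix_vector_mul_bounded_linear bounded_linear_const_scaleR bounded_linear_ident)
    from bounded_linear.has_vector_derivative[OF this costate_has_vector_derivative]
    have "(f i has_vector_derivative (-1) ^ i *\<^sub>R (M i *v - (transpose A *v costate A a s))) (at s)"
      unfolding f_def[abs_def] .
    moreover have "M i *v (transpose A *v y) = M (Suc i) *v y" for y
      unfolding M_def matpow_Suc_right matrix_vector_mul_assoc matrix_mul_assoc ..
    then have "(-1) ^ i *\<^sub>R (M i *v - (transpose A *v costate A a s)) = f (Suc i) s"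
      by (simp add: f_def linear_neg[OF matrix_vector_mul_linear] del: transpose_matrix_vector)
    ultimately show ?thesis by simp
  qed
  define k where "k = (LEAST i. M i *v costate A a t \<noteq> 0)"
  have k: "M k *v costate A a t \<noteq> 0"
    unfolding k_def by (rule LeastI_ex) (use costate_detected[OF a] in \<open>simp add: M_def\<close>)
  have less_k: "M i *v costate A a t = 0" if "i < k" for i
    using not_less_Least[of i] that unfolding k_def by blast
  define c where "c = f k t /\<^sub>R fact k"
  have c: "c \<noteq> 0" using k by (simp add: c_def f_def)
  have lim: "((\<lambda>s. f 0 s /\<^sub>R (s - t) ^ k) \<longlongrightarrow> c) (at t)"
    unfolding c_def by (rule Taylor_leading_term[of f, OF f_deriv]) (simp add: f_def less_k)
  have f0: "f 0 s = transpose B *v costate A a s" for s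
    by (simp add: f_def M_def del: transpose_matrix_vector)
  have ev: "\<forall>\<^sub>F s in at t. f 0 s \<noteq> 0 \<longrightarrow> us s = sgn (f 0 s)"
  proof -
    \<comment> \<open>The point \<open>t\<close> is taken out of the exceptional set, so that its complement is a neighbourhood of \<open>t\<close>.\<close>
    define D where "D = {s. 0 < s \<and> \<not> isCont us s} - {t}"
    have "finite D" using us(1) by (simp add: PC_def D_def)
    then have "open ({0<..<T} - D)"
      by (intro open_Diff open_greaterThanLessThan finite_imp_closed)
    moreover have "t \<in> {0<..<T} - D" using t by (simp add: D_def)
    ultimately have "\<forall>\<^sub>F s in nhds t. s \<in> {0<..<T} - D" by (rule eventually_nhds_in_open)
    then show ?thesis
      unfolding eventually_at_filter
    proof eventually_elim
      case (elim s)
      show ?case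
      proof (intro impI)
        assume "s \<noteq> t" "f 0 s \<noteq> 0"
        with elim show "us s = sgn (f 0 s)"
          unfolding f0 by (intro optimal_control_eq_sgn[OF us(1) max]) (auto simp: D_def)
      qed
    qed
  qed
  note lims = sgn_direction_at_zero[OF lim c ev]
  have left: "(us \<longlongrightarrow> us t) (at_left t)" using us(1) t(1) by (simp add: PC_def)
  have us_t: "us t = (-1) ^ k *\<^sub>R sgn c"
    by (rule tendsto_unique[OF _ left lims(2)]) simp
  have odd: "odd k"
  proof
    assume "even k"
    then have "(us \<longlongrightarrow> us t) (at t)"
      using lims(1) left by (simp add: us_t filterlim_at_split)
    then show False using t(3) by (simp add: isCont_def)
  qed
  \<comment> \<open>The positive factor that normalises the costate.\<close>
  define \<rho> where "\<rho> = inverse (norm c) * inverse (fact k)"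
  have "us t = M k *v (\<rho> *\<^sub>R costate A a t)"
    using odd by (simp add: us_t c_def f_def \<rho>_def sgn_div_norm matrix_vector_mult_scaleR)
  then have "(us \<longlongrightarrow> M k *v (\<rho> *\<^sub>R costate A a t)) (at_left t)"
    using left by simp
  moreover have "M i *v (\<rho> *\<^sub>R costate A a t) = 0" if "i < k" for i
    using less_k[OF that] by (simp add: matrix_vector_mult_scaleR)
  moreover have "k < CARD('n)"
    using krylov_order_bound[OF B, of k A "costate A a t"] k less_k unfolding M_def by blast
  ultimately show thesis
    using that[OF odd] unfolding M_def by blast
qed

theorem theorem1p5:
  fixes A :: "real^'n^'n" and B :: "real^'m^'n" and x0 :: "real^'n"
    and ustar :: "real \<Rightarrow> real^'m"
  assumes "B \<noteq> 0" and "x0 \<noteq> 0"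
    and "\<exists>u. admissible_control A B x0 u"
    and "optimal_control A B x0 ustar"
  shows "(CARD('n) \<ge> 2 \<and> switching_points A B x0 ustar \<noteq> {} \<longrightarrow>
            switching_directions A B x0 ustar \<subseteq>
              sphere 0 1 \<inter>
              (\<Union>j\<in>{1..CARD('n) div 2}.
                 (\<lambda>h. (transpose B ** matpow (transpose A) (2 * j - 1)) *v h)
                   ` krylov_increment A B (2 * j - 1)))
         \<and> (CARD('n) = 1 \<longrightarrow> switching_points A B x0 ustar = {})"
proof (intro conjI impI subsetI)
  fix v assume v: "v \<in> switching_directions A B x0 ustar"
  then obtain t where t: "t \<in> switching_points A B x0 ustar" and lim: "(ustar \<longlongrightarrow> v) (at_left t)"
    by (auto simp: switching_directions_def)
  from switching_point_structure[OF assms(1,4) t] obtain k w where k: "odd k" "k < CARD('n)"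
    and w: "\<And>i. i < k \<Longrightarrow> (transpose B ** matpow (transpose A) i) *v w = 0"
    and lim': "(ustar \<longlongrightarrow> (transpose B ** matpow (transpose A) k) *v w) (at_left t)"
    by metis
  have v_eq: "v = (transpose B ** matpow (transpose A) k) *v w"
    by (rule tendsto_unique[OF _ lim lim']) simp
  from k(1) have "k > 0" by (rule odd_pos)
  note krylov_increment_image[OF this w, folded v_eq]
  moreover have "k = 2 * ((k + 1) div 2) - 1" "(k + 1) div 2 \<in> {1..CARD('n) div 2}"
    using k \<open>k > 0\<close> by (auto elim!: oddE)
  ultimately have "v \<in> (\<Union>j\<in>{1..CARD('n) div 2}.
                 (\<lambda>h. (transpose B ** matpow (transpose A) (2 * j - 1)) *v h)
                   ` krylov_increment A B (2 * j - 1))"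
    by (metis (no_types, lifting) UN_I)
  moreover have "v \<in> sphere 0 1" using v by (simp add: switching_directions_def)
  ultimately show "v \<in> sphere 0 1 \<inter> (\<Union>j\<in>{1..CARD('n) div 2}.
                 (\<lambda>h. (transpose B ** matpow (transpose A) (2 * j - 1)) *v h)
                   ` krylov_increment A B (2 * j - 1))" by blast
next
  assume n: "CARD('n) = 1"
  show "switching_points A B x0 ustar = {}"
  proof (rule equals0I)
    fix t assume "t \<in> switching_points A B x0 ustar"
    then obtain k :: nat where "odd k" "k < CARD('n)"
      using switching_point_structure[OF assms(1,4)] by metis
    then show False using n by simp
  qed
qed

end
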